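(* Let $X$ be a finite dataset, and fix $k\in\mathbb{Z}$, a collection of bins $\mathbb{B}$ of $X$, and a positive integer $MinPts$. Let $\epsilon_0\le\epsilon_1\le\dots\le\epsilon_m$ be real numbers, and for each $i$ let DBSCAN with parameters $\epsilon_i$ and $MinPts$ be used to cluster each bin of $\mathbb{B}$, giving the cluster cover $\mathbb{C}_{\epsilon_i}$. Suppose that for each $i$ there are no free-border points with respect to $\epsilon_i$ and $MinPts$ (in any bin of $\mathbb{B}$). Then: (1) there is a filtration of simplicial complexes $\{\phi^{\epsilon_i,\epsilon_j}:\mathbb{N}(\mathbb{C}_{\epsilon_i})\to\mathbb{N}(\mathbb{C}_{\epsilon_j}),\ \forall\,\epsilon_i\le\epsilon_j\}$, induced by a filtration of the cluster covers $\mathbb{C}_{\epsilon_i}$, where $\mathbb{N}(\mathbb{C}_{\epsilon_i})$ is the nerve whose vertices are the clusters with respect to $\epsilon_i$ and $MinPts$; (2) there is an induced filtration of homology groups $\{f^{\epsilon_i,\epsilon_j}:H_k(\mathbb{N}(\mathbb{C}_{\epsilon_i}))\to H_k(\mathbb{N}(\mathbb{C}_{\epsilon_j})),\ \forall\,\epsilon_i\le\epsilon_j\}$.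
   Context: DBSCAN. Let $Y$ be a finite (ordered) set of points in a metric space, $\epsilon\in\mathbb{R}$, $MinPts$ a positive integer, and $N_\epsilon(p)=\{q\in Y: dist(p,q)\le\epsilon\}$ for $p\in Y$. A point $p\in Y$ is a core point if $|N_\epsilon(p)|\ge MinPts$; a border point if it is not core but lies in $N_\epsilon(p')$ for some core point $p'$; and noise otherwise. A point $q$ is directly density-reachable from $p$ if $p$ is core and $q\in N_\epsilon(p)$. A point $q$ is density-reachable from $p$ if there are points $p=\alpha_1,\dots,\alpha_n=q$ in $Y$, $n\ge 2$, with each $\alpha_{i+1}$ directly density-reachable from $\alpha_i$. Points $p,q$ are density-connected if there is a point $o\in Y$ from which both are density-reachable. DBSCAN outputs a partition $Y=C_1\sqcup\dots\sqcup C_n\sqcup N$, with $N$ the set of noise points and the clusters $C_i$, each containing at least one core point, satisfying: (Maximality) if $p\in C_i$, $q\notin \bigsqcup_{j<i}C_j$ and $q$ is density-reachable from $p$, then $q\in C_i$; (Connectivity) any $p,q\in C_i$ are density-connected. The assignment of some border points may depend on the ordering of $Y$. A point $s\in Y$ is a free-border point with respect to $\epsilon$ and $MinPts$ if $|N_\epsilon(s)|<MinPts$ and there are core points $p,q\in Y$ with $s\in N_\epsilon(p)$, $s\in N_\epsilon(q)$ and $p$ not density-connected to $q$. Bins and cluster covers. A bin is a subset of $X$; $\mathbb{B}$ is a finite indexed collection of bins covering $X$. DBSCAN is run separately inside each bin (with $Y$ = the bin). The cluster cover is the family of all clusters so obtained, indexed by the bin they come from (clusters in different bins are different elements even if equal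 as sets); noise points belong to no cluster, and the word "cover" is used regardless. Filtrations. A family $\{\mathbb{U}_\lambda\}$ of (cluster) covers indexed by a partially ordered parameter set is a filtration if it has maps $u^{\lambda,\mu}:\mathbb{U}_\lambda\to\mathbb{U}_\mu$ for $\lambda\le\mu$ such that $u^{\lambda,\mu}(U)=V$ implies $U\subseteq V$, and $u^{\mu,\nu}\circ u^{\lambda,\mu}=u^{\lambda,\nu}$ for $\lambda\le\mu\le\nu$. The nerve $\mathbb{N}(\mathbb{U})$ of an indexed family $\mathbb{U}=\{U_\alpha\}_{\alpha\in A}$ is the simplicial complex with vertex set $A$ in which $\{\alpha_0,\dots,\alpha_n\}$ is a simplex iff $U_{\alpha_0}\cap\dots\cap U_{\alpha_n}\ne\emptyset$. A filtration of simplicial complexes (resp. homology groups) is a family of simplicial maps (resp. homomorphisms) $\phi^{\lambda,\mu}$ for $\lambda\le\mu$ with $\phi^{\mu,\nu}\circ\phi^{\lambda,\mu}=\phi^{\lambda,\nu}$. It is induced by a filtration of cluster covers if the simplicial maps act on vertices by the maps of the cluster-cover filtration, and the homomorphisms are the maps induced on $H_k$ by these simplicial maps. Homology is simplicial, with a fixed coefficient group. *)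

theory Defs
  imports Complex_Main "HOL-Algebra.Coset" "HOL-Algebra.FiniteProduct"
    "HOL-Combinatorics.Permutations"
begin

section \<open>DBSCAN\<close>

definition eps_nbhd :: "'a::metric_space set \<Rightarrow> real \<Rightarrow> 'a \<Rightarrow> 'a set" where
  "eps_nbhd Y e p = {q \<in> Y. dist p q \<le> e}"

definition core_point :: "'a::metric_space set \<Rightarrow> real \<Rightarrow> nat \<Rightarrow> 'a \<Rightarrow> bool" where
  "core_point Y e M p \<longleftrightarrow> p \<in> Y \<and> card (eps_nbhd Y e p) \<ge> M"

definition border_point :: "'a::metric_space set \<Rightarrow> real \<Rightarrow> nat \<Rightarrow> 'a \<Rightarrow> bool" where
  "border_point Y e M p \<longleftrightarrow>
     p \<in> Y \<and> \<not> core_point Y e M p \<and> (\<exists>p'. core_point Y e M p' \<and> p \<in> eps_nbhd Y e p')"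

definition noise_points :: "'a::metric_space set \<Rightarrow> real \<Rightarrow> nat \<Rightarrow> 'a set" where
  "noise_points Y e M = {p \<in> Y. \<not> core_point Y e M p \<and> \<not> border_point Y e M p}"

definition directly_density_reachable ::
  "'a::metric_space set \<Rightarrow> real \<Rightarrow> nat \<Rightarrow> 'a \<Rightarrow> 'a \<Rightarrow> bool" where
  "directly_density_reachable Y e M p q \<longleftrightarrow> core_point Y e M p \<and> q \<in> eps_nbhd Y e p"

text \<open>Read \<open>density_reachable Y e M p q\<close> as ``\<open>q\<close> is density-reachable from \<open>p\<close>''.\<close>

definition density_reachable ::
  "'a::metric_space set \<Rightarrow> real \<Rightarrow> nat \<Rightarrow> 'a \<Rightarrow> 'a \<Rightarrow> bool" where
  "density_reachable Y e M p q \<longleftrightarrow>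
     (\<exists>as. length as \<ge> 2 \<and> set as \<subseteq> Y \<and> hd as = p \<and> last as = q \<and>
        (\<forall>i. Suc i < length as \<longrightarrow> directly_density_reachable Y e M (as ! i) (as ! Suc i)))"

definition density_connected ::
  "'a::metric_space set \<Rightarrow> real \<Rightarrow> nat \<Rightarrow> 'a \<Rightarrow> 'a \<Rightarrow> bool" where
  "density_connected Y e M p q \<longleftrightarrow>
     (\<exists>o'\<in>Y. density_reachable Y e M o' p \<and> density_reachable Y e M o' q)"

definition free_border_point :: "'a::metric_space set \<Rightarrow> real \<Rightarrow> nat \<Rightarrow> 'a \<Rightarrow> bool" where
  "free_border_point Y e M s \<longleftrightarrow>
     s \<in> Y \<and> card (eps_nbhd Y e s) < M \<and>
     (\<exists>p q. core_point Y e M p \<and> core_point Y e M q \<and>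
        s \<in> eps_nbhd Y e p \<and> s \<in> eps_nbhd Y e q \<and> \<not> density_connected Y e M p q)"

text \<open>
  The outcome of DBSCAN depends on the ordering of the points only through the assignment of
  border points and the numbering of the clusters.  It is modelled as a relation:
  \<open>Cs\<close> is a possible list \<open>[C\<^sub>1, \<dots>, C\<^sub>n]\<close> of clusters (numbered from \<open>0\<close> below).
\<close>

definition dbscan_output :: "'a::metric_space set \<Rightarrow> real \<Rightarrow> nat \<Rightarrow> 'a set list \<Rightarrow> bool" where
  "dbscan_output Y e M Cs \<longleftrightarrow>
     Y = \<Union> (set Cs) \<union> noise_points Y e M \<and>
     (\<forall>C \<in> set Cs. C \<inter> noise_points Y e M = {}) \<and>
     (\<forall>i j. i < j \<and> j < length Cs \<longrightarrow> Cs ! i \<inter> Cs ! j = {}) \<and>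
     (\<forall>C \<in> set Cs. \<exists>p\<in>C. core_point Y e M p) \<and>
     (\<forall>i < length Cs. \<forall>p q. p \<in> Cs ! i \<and> q \<notin> (\<Union>j<i. Cs ! j) \<and> density_reachable Y e M p q
        \<longrightarrow> q \<in> Cs ! i) \<and>
     (\<forall>C \<in> set Cs. \<forall>p\<in>C. \<forall>q\<in>C. density_connected Y e M p q)"


section \<open>Covers by bins, cluster covers and their filtrations\<close>

definition bin_collection :: "'a set \<Rightarrow> 'b set \<Rightarrow> ('b \<Rightarrow> 'a set) \<Rightarrow> bool" where
  "bin_collection X J B \<longleftrightarrow> finite J \<and> (\<forall>b\<in>J. B b \<subseteq> X) \<and> (\<Union>b\<in>J. B b) = X"

text \<open>
  \<open>Cs b\<close> is the list of clusters found in the bin with index \<open>b\<close>.  An element of the cluster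
  cover is a cluster tagged with the bin it comes from; the underlying set is its second
  component.
\<close>

definition cluster_cover :: "'b set \<Rightarrow> ('b \<Rightarrow> 'a set list) \<Rightarrow> ('b \<times> 'a set) set" where
  "cluster_cover J Cs = (SIGMA b:J. set (Cs b))"

text \<open>
  In the three notions of filtration below, \<open>T\<close> is the set of parameters and \<open>R\<close> its order relation.
  An indexed family of sets is given by its index set \<open>A\<close> and the map \<open>S\<close> from indices to sets.
\<close>

definition cover_filtration ::
  "'i set \<Rightarrow> ('i \<Rightarrow> 'i \<Rightarrow> bool) \<Rightarrow> ('i \<Rightarrow> 'v set) \<Rightarrow> ('i \<Rightarrow> 'v \<Rightarrow> 'a set) \<Rightarrow>
   ('i \<Rightarrow> 'i \<Rightarrow> 'v \<Rightarrow> 'v) \<Rightarrow> bool" where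
  "cover_filtration T R A S u \<longleftrightarrow>
     (\<forall>i\<in>T. \<forall>j\<in>T. R i j \<longrightarrow>
        u i j \<in> A i \<rightarrow> A j \<and> (\<forall>a \<in> A i. S i a \<subseteq> S j (u i j a))) \<and>
     (\<forall>i\<in>T. \<forall>j\<in>T. \<forall>l\<in>T. R i j \<and> R j l \<longrightarrow> (\<forall>a \<in> A i. u j l (u i j a) = u i l a))"


section \<open>Simplicial complexes and nerves\<close>

text \<open>A complex is given by its set of simplices; its vertex set is the union of them.\<close>

definition simplicial_complex :: "'v set set \<Rightarrow> bool" where
  "simplicial_complex K \<longleftrightarrow>
     (\<forall>s\<in>K. finite s \<and> s \<noteq> {} \<and> (\<forall>t. t \<subseteq> s \<and> t \<noteq> {} \<longrightarrow> t \<in> K))"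

definition simplicial_map :: "'v set set \<Rightarrow> 'w set set \<Rightarrow> ('v \<Rightarrow> 'w) \<Rightarrow> bool" where
  "simplicial_map K L \<phi> \<longleftrightarrow> (\<forall>s\<in>K. \<phi> ` s \<in> L)"

definition complex_filtration ::
  "'i set \<Rightarrow> ('i \<Rightarrow> 'i \<Rightarrow> bool) \<Rightarrow> ('i \<Rightarrow> 'v set set) \<Rightarrow> ('i \<Rightarrow> 'i \<Rightarrow> 'v \<Rightarrow> 'v) \<Rightarrow> bool" where
  "complex_filtration T R K \<phi> \<longleftrightarrow>
     (\<forall>i\<in>T. simplicial_complex (K i)) \<and>
     (\<forall>i\<in>T. \<forall>j\<in>T. R i j \<longrightarrow> simplicial_map (K i) (K j) (\<phi> i j)) \<and>
     (\<forall>i\<in>T. \<forall>j\<in>T. \<forall>l\<in>T. R i j \<and> R j l \<longrightarrow>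
        (\<forall>v \<in> \<Union> (K i). \<phi> j l (\<phi> i j v) = \<phi> i l v))"

text \<open>An index of an empty set spans no simplex; clusters are never empty.\<close>

definition nerve :: "'v set \<Rightarrow> ('v \<Rightarrow> 'a set) \<Rightarrow> 'v set set" where
  "nerve A S = {s. s \<subseteq> A \<and> finite s \<and> s \<noteq> {} \<and> (\<Inter>a\<in>s. S a) \<noteq> {}}"

definition cluster_nerve :: "'b set \<Rightarrow> ('b \<Rightarrow> 'a set list) \<Rightarrow> ('b \<times> 'a set) set set" where
  "cluster_nerve J Cs = nerve (cluster_cover J Cs) snd"


section \<open>Simplicial homology with coefficients\<close>

text \<open>
  A \<open>k\<close>-chain with coefficients in the abelian group \<open>G\<close> (written multiplicatively) is an
  alternating, finitely supported function on ordered \<open>k\<close>-simplices, that is, a finitely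
  supported function on oriented simplices that changes sign with the orientation.  The
  elementary chain \<open>g\<cdot>[v\<^sub>0, \<dots>, v\<^sub>k]\<close> takes the value \<open>g\<close> at \<open>[v\<^sub>0, \<dots>, v\<^sub>k]\<close> and its even permutations,
  the inverse of \<open>g\<close> at the odd ones, and is trivial elsewhere.  There are no simplices
  of negative dimension, so the chain groups in negative degrees are trivial.
\<close>

definition simplicial_chains ::
  "('g, 'm) monoid_scheme \<Rightarrow> 'v set set \<Rightarrow> int \<Rightarrow> ('v list \<Rightarrow> 'g) set" where
  "simplicial_chains G K k = {c.
     (\<forall>v. c v \<in> carrier G) \<and>
     finite {v. c v \<noteq> \<one>\<^bsub>G\<^esub>} \<and>
     (\<forall>v. c v \<noteq> \<one>\<^bsub>G\<^esub> \<longrightarrow> int (length v) = k + 1 \<and> distinct v \<and> set v \<in> K) \<and>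
     (\<forall>v p. p permutes {..<length v} \<longrightarrow>
        c (permute_list p v) = (if evenperm p then c v else inv\<^bsub>G\<^esub> (c v)))}"

definition simplicial_chain_group ::
  "('g, 'm) monoid_scheme \<Rightarrow> 'v set set \<Rightarrow> int \<Rightarrow> ('v list \<Rightarrow> 'g) monoid" where
  "simplicial_chain_group G K k =
     \<lparr>carrier = simplicial_chains G K k,
      monoid.mult = (\<lambda>c d v. c v \<otimes>\<^bsub>G\<^esub> d v),
      one = (\<lambda>v. \<one>\<^bsub>G\<^esub>)\<rparr>"

text \<open>
  The elementary chain of \<open>[v\<^sub>0, \<dots>, v\<^sub>k]\<close> is sent to the alternating sum of those of its faces:
  if \<open>w\<close> arises from \<open>[v\<^sub>0, \<dots>, v\<^sub>k]\<close> by deleting \<open>v\<^sub>i\<close>, then \<open>v\<^sub>i # w\<close> differs from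
  \<open>[v\<^sub>0, \<dots>, v\<^sub>k]\<close> by a permutation of sign \<open>(-1)\<^sup>i\<close>.  The value at \<open>[]\<close> is set to be
  trivial because homology is not reduced.
\<close>

definition simplicial_boundary ::
  "('g, 'm) monoid_scheme \<Rightarrow> ('v list \<Rightarrow> 'g) \<Rightarrow> 'v list \<Rightarrow> 'g" where
  "simplicial_boundary G c w =
     (if w = [] then \<one>\<^bsub>G\<^esub>
      else finprod G (\<lambda>x. c (x # w)) {x. c (x # w) \<noteq> \<one>\<^bsub>G\<^esub>})"

definition simplicial_cycles ::
  "('g, 'm) monoid_scheme \<Rightarrow> 'v set set \<Rightarrow> int \<Rightarrow> ('v list \<Rightarrow> 'g) set" where
  "simplicial_cycles G K k =
     kernel (simplicial_chain_group G K k) (simplicial_chain_group G K (k - 1))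
       (simplicial_boundary G)"

definition simplicial_boundaries ::
  "('g, 'm) monoid_scheme \<Rightarrow> 'v set set \<Rightarrow> int \<Rightarrow> ('v list \<Rightarrow> 'g) set" where
  "simplicial_boundaries G K k = simplicial_boundary G ` simplicial_chains G K (k + 1)"

definition simplicial_homology ::
  "('g, 'm) monoid_scheme \<Rightarrow> 'v set set \<Rightarrow> int \<Rightarrow> ('v list \<Rightarrow> 'g) set monoid" where
  "simplicial_homology G K k =
     (simplicial_chain_group G K k)\<lparr>carrier := simplicial_cycles G K k\<rparr>
       Mod simplicial_boundaries G K k"

definition homology_class ::
  "('g, 'm) monoid_scheme \<Rightarrow> 'v set set \<Rightarrow> int \<Rightarrow> ('v list \<Rightarrow> 'g) \<Rightarrow> ('v list \<Rightarrow> 'g) set" where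
  "homology_class G K k c =
     simplicial_boundaries G K k #>\<^bsub>simplicial_chain_group G K k\<^esub> c"

text \<open>
  The chain map sends \<open>g\<cdot>[v\<^sub>0, \<dots>, v\<^sub>k]\<close> to \<open>g\<cdot>[\<phi> v\<^sub>0, \<dots>, \<phi> v\<^sub>k]\<close>, understood as trivial if the
  \<open>\<phi> v\<^sub>i\<close> are not distinct.
\<close>

definition simplicial_chain_map ::
  "('g, 'm) monoid_scheme \<Rightarrow> ('v \<Rightarrow> 'w) \<Rightarrow> ('v list \<Rightarrow> 'g) \<Rightarrow> 'w list \<Rightarrow> 'g" where
  "simplicial_chain_map G \<phi> c w =
     (if distinct w then finprod G c {v. c v \<noteq> \<one>\<^bsub>G\<^esub> \<and> map \<phi> v = w} else \<one>\<^bsub>G\<^esub>)"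

definition induced_on_homology ::
  "('g, 'm) monoid_scheme \<Rightarrow> 'v set set \<Rightarrow> 'w set set \<Rightarrow> int \<Rightarrow> ('v \<Rightarrow> 'w) \<Rightarrow>
   (('v list \<Rightarrow> 'g) set \<Rightarrow> ('w list \<Rightarrow> 'g) set) \<Rightarrow> bool" where
  "induced_on_homology G K L k \<phi> f \<longleftrightarrow>
     (\<forall>c \<in> simplicial_cycles G K k.
        f (homology_class G K k c) = homology_class G L k (simplicial_chain_map G \<phi> c))"

definition group_filtration ::
  "'i set \<Rightarrow> ('i \<Rightarrow> 'i \<Rightarrow> bool) \<Rightarrow> ('i \<Rightarrow> 'h monoid) \<Rightarrow> ('i \<Rightarrow> 'i \<Rightarrow> 'h \<Rightarrow> 'h) \<Rightarrow> bool" where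
  "group_filtration T R H f \<longleftrightarrow>
     (\<forall>i\<in>T. group (H i)) \<and>
     (\<forall>i\<in>T. \<forall>j\<in>T. R i j \<longrightarrow> f i j \<in> hom (H i) (H j)) \<and>
     (\<forall>i\<in>T. \<forall>j\<in>T. \<forall>l\<in>T. R i j \<and> R j l \<longrightarrow>
        (\<forall>x \<in> carrier (H i). f j l (f i j x) = f i l x))"

end

theory Submission
  imports Defs
begin

text \<open>
  The theorem rests on one geometric fact: for \<open>e \<le> e'\<close>, if there are no free-border points at
  \<open>e'\<close>, then every cluster at \<open>e\<close> is contained in exactly one cluster at \<open>e'\<close>
  (\<open>dbscan_cluster_nested\<close>).  Core points remain core and density-reachability is preserved when
  the radius grows, so it is enough that each cluster at \<open>e'\<close> is closed under
  density-reachability.  For core points this follows from Maximality, since steps between core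
  points are reversible.  For border points it can fail, because an earlier cluster may have claimed
  the point; a border point near core points of two different clusters is just what a free-border
  point is (\<open>dbscan_neighbour_in_cluster\<close>).

  Sending a cluster to the unique cluster of the same bin that contains it is functorial because of
  uniqueness.  This also covers parameters \<open>i > j\<close> with equal radius, where the two
  outputs of DBSCAN need not be the same list: the nesting lemma does not compare positions in the
  lists.  Inclusions preserve common points, so the vertex maps are simplicial on the nerves.

  The rest is functoriality of simplicial homology, for chains that are alternating functions on
  lists of vertices.  The two computations that matter, that the boundary squares to zero
  (\<open>simplicial_boundary_boundary\<close>) and commutes with chain maps
  (\<open>simplicial_boundary_chain_map\<close>), are both instances of the same cancellation: swapping the
  head of a list with a suitable other entry is an involution without fixed points under which an
  alternating chain changes sign (\<open>finprod_sign_reversing_involution\<close>).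
\<close>

section \<open>Clusters at increasing radii\<close>

text \<open>
  Reachability is used through the transitive closure only, which provides induction along paths
  and access to the first and the last step of a path.
\<close>

lemma density_reachable_tranclp:
  assumes "density_reachable Y e M p q"
  shows "(directly_density_reachable Y e M)\<^sup>+\<^sup>+ p q"
proof -
  from assms obtain as where len: "length as \<ge> 2" and ends: "hd as = p" "last as = q"
    and step: "\<And>i. Suc i < length as \<Longrightarrow> directly_density_reachable Y e M (as ! i) (as ! Suc i)"
    unfolding density_reachable_def by blast
  have "(directly_density_reachable Y e M)\<^sup>+\<^sup>+ (as ! 0) (as ! Suc n)" if "Suc n < length as" for n
    using that
  proof (induction n)
    case 0
    then show ?case using step by blast
  next
    case (Suc n)
    then show ?case using step[of "Suc n"] by (meson Suc_lessD tranclp.trancl_into_trancl)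
  qed
  moreover have "Suc (length as - 2) = length as - 1" "as \<noteq> []"
    using len by auto
  ultimately show ?thesis
    using len ends by (metis diff_less hd_conv_nth last_conv_nth length_greater_0_conv less_one)
qed

lemma directly_density_reachable_imp_density_reachable:
  assumes "directly_density_reachable Y e M p q"
  shows "density_reachable Y e M p q"
  unfolding density_reachable_def
  by (rule exI[of _ "[p, q]"])
     (use assms in \<open>auto simp: directly_density_reachable_def core_point_def eps_nbhd_def less_Suc_eq\<close>)

lemma directly_density_reachable_sym:
  assumes "directly_density_reachable Y e M p q" "core_point Y e M q"
  shows "directly_density_reachable Y e M q p"
  using assms by (auto simp: directly_density_reachable_def core_point_def eps_nbhd_def dist_commute)

lemma tranclp_source_core_point:
  assumes "(directly_density_reachable Y e M)\<^sup>+\<^sup>+ p q"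
  shows "core_point Y e M p"
  using tranclpD[OF assms] by (auto simp: directly_density_reachable_def)

lemma eps_nbhd_mono: "e \<le> e' \<Longrightarrow> eps_nbhd Y e p \<subseteq> eps_nbhd Y e' p"
  by (auto simp: eps_nbhd_def)

lemma core_point_mono:
  assumes "finite Y" "e \<le> e'" "core_point Y e M p"
  shows "core_point Y e' M p"
proof -
  have "card (eps_nbhd Y e p) \<le> card (eps_nbhd Y e' p)"
    using assms(1) by (intro card_mono eps_nbhd_mono assms) (auto simp: eps_nbhd_def)
  with assms(3) show ?thesis by (auto simp: core_point_def)
qed

lemma directly_density_reachable_mono:
  assumes "finite Y" "e \<le> e'" "directly_density_reachable Y e M p q"
  shows "directly_density_reachable Y e' M p q"
  using core_point_mono[OF assms(1,2)] subsetD[OF eps_nbhd_mono[OF assms(2)]] assms(3)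
  unfolding directly_density_reachable_def by blast

lemma dbscan_outputD:
  assumes "dbscan_output Y e M Cs"
  shows "Y = \<Union> (set Cs) \<union> noise_points Y e M"
    and "\<forall>i j. i < j \<and> j < length Cs \<longrightarrow> Cs ! i \<inter> Cs ! j = {}"
    and "\<forall>C \<in> set Cs. \<exists>p\<in>C. core_point Y e M p"
    and "\<forall>i < length Cs. \<forall>p q. p \<in> Cs ! i \<and> q \<notin> (\<Union>j<i. Cs ! j) \<and> density_reachable Y e M p q
          \<longrightarrow> q \<in> Cs ! i"
    and "\<forall>C \<in> set Cs. \<forall>p\<in>C. \<forall>q\<in>C. density_connected Y e M p q"
  using assms unfolding dbscan_output_def by - (elim conjE; assumption)+

lemma dbscan_core_point_in_cluster:
  assumes "dbscan_output Y e M Cs" "core_point Y e M p"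
  obtains i where "i < length Cs" "p \<in> Cs ! i"
proof -
  have "p \<in> Y" "p \<notin> noise_points Y e M"
    using assms(2) by (auto simp: core_point_def noise_points_def)
  with dbscan_outputD(1)[OF assms(1)] have "p \<in> \<Union> (set Cs)"
    by blast
  then show ?thesis using that by (auto simp: in_set_conv_nth)
qed

lemma dbscan_cluster_index_unique:
  assumes "dbscan_output Y e M Cs" "i < length Cs" "j < length Cs" "p \<in> Cs ! i" "p \<in> Cs ! j"
  shows "i = j"
proof -
  have disj: "Cs ! i \<inter> Cs ! j = {}" if "i < j" "j < length Cs" for i j
    using dbscan_outputD(2)[OF assms(1)] that by blast
  show ?thesis
    using disj[of i j] disj[of j i] assms(2-) by (cases i j rule: linorder_cases) auto
qed

lemma dbscan_maximality:
  assumes "dbscan_output Y e M Cs" "i < length Cs" "p \<in> Cs ! i"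
    and "directly_density_reachable Y e M p q" "\<And>j. j < i \<Longrightarrow> q \<notin> Cs ! j"
  shows "q \<in> Cs ! i"
  using dbscan_outputD(4)[OF assms(1)] assms directly_density_reachable_imp_density_reachable[OF assms(4)]
  by blast

text \<open>
  Maximality says nothing about points that an earlier cluster has already claimed.  A step between
  core points can however be reversed, so an earlier cluster containing \<open>q\<close> would itself have
  to claim \<open>p\<close>, against disjointness.
\<close>

lemma dbscan_core_neighbour_in_cluster:
  assumes out: "dbscan_output Y e M Cs" and i: "i < length Cs" "p \<in> Cs ! i"
    and step: "directly_density_reachable Y e M p q" and q: "core_point Y e M q"
  shows "q \<in> Cs ! i"
proof (rule dbscan_maximality[OF out i step])
  fix j assume "j < i"
  then have j: "j < length Cs" using i by simp
  show "q \<notin> Cs ! j"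
  proof
    assume "q \<in> Cs ! j"
    then have "p \<in> Cs ! j"
    proof (rule dbscan_maximality[OF out j _ directly_density_reachable_sym[OF step q]])
      show "p \<notin> Cs ! l" if "l < j" for l
        using dbscan_cluster_index_unique[OF out, of l i p] i j that \<open>j < i\<close> by auto
    qed
    then show False
      using dbscan_cluster_index_unique[OF out j i(1) _ i(2)] \<open>j < i\<close> by simp
  qed
qed

lemma dbscan_core_path_in_cluster:
  assumes out: "dbscan_output Y e M Cs" and i: "i < length Cs" "p \<in> Cs ! i"
    and "(directly_density_reachable Y e M)\<^sup>+\<^sup>+ p q" and "core_point Y e M q"
  shows "q \<in> Cs ! i"
  using assms(4,5)
proof (induction rule: tranclp_induct)
  case (base q)
  then show ?case using dbscan_core_neighbour_in_cluster[OF out i] by blast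
next
  case (step q r)
  then have "q \<in> Cs ! i" by (simp add: directly_density_reachable_def)
  with step dbscan_core_neighbour_in_cluster[OF out i(1)] show ?case by blast
qed

text \<open>
  The point \<open>o'\<close> from which both points are reached is a core point, hence lies in
  some cluster, and all points but possibly the last on a path are core points.  So the cluster
  of \<open>o'\<close> is also that of \<open>p\<close> and of \<open>q\<close>.
\<close>

lemma dbscan_connected_core_points_same_cluster:
  assumes out: "dbscan_output Y e M Cs" and i: "i < length Cs" "p \<in> Cs ! i"
    and conn: "density_connected Y e M p q" and core: "core_point Y e M p" "core_point Y e M q"
  shows "q \<in> Cs ! i"
proof -
  from conn obtain o' where o': "(directly_density_reachable Y e M)\<^sup>+\<^sup>+ o' p"
      "(directly_density_reachable Y e M)\<^sup>+\<^sup>+ o' q"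
    unfolding density_connected_def using density_reachable_tranclp by blast
  obtain k where k: "k < length Cs" "o' \<in> Cs ! k"
    using dbscan_core_point_in_cluster[OF out tranclp_source_core_point[OF o'(1)]] .
  have "p \<in> Cs ! k" "q \<in> Cs ! k"
    using dbscan_core_path_in_cluster[OF out k] o' core by blast+
  then show ?thesis
    using dbscan_cluster_index_unique[OF out] k i by blast
qed

text \<open>
  This is where free-border points must be excluded.  A border point \<open>q\<close> near the core point
  \<open>p\<close> of cluster \<open>i\<close> lies in some cluster \<open>j\<close>, and Connectivity puts it near a core
  point of that cluster too.  Since \<open>q\<close> is not a free-border point, the two core points are
  density-connected, which forces \<open>i = j\<close>.  Consequently every cluster is closed under
  density-reachability, independently of the numbering of the clusters.
\<close>

lemma dbscan_neighbour_in_cluster: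
  assumes out: "dbscan_output Y e M Cs" and nofree: "\<And>s. \<not> free_border_point Y e M s"
    and i: "i < length Cs" "p \<in> Cs ! i" and step: "directly_density_reachable Y e M p q"
  shows "q \<in> Cs ! i"
proof (cases "core_point Y e M q")
  case True
  then show ?thesis using dbscan_core_neighbour_in_cluster[OF out i step] by blast
next
  case False
  from step have p: "core_point Y e M p" and q: "q \<in> eps_nbhd Y e p" "q \<in> Y"
    by (auto simp: directly_density_reachable_def eps_nbhd_def)
  then have "q \<notin> noise_points Y e M"
    by (auto simp: noise_points_def border_point_def)
  with dbscan_outputD(1)[OF out] q(2) have "q \<in> \<Union> (set Cs)"
    by blast
  then obtain j where j: "j < length Cs" "q \<in> Cs ! j"
    by (auto simp: in_set_conv_nth)
  obtain r where r: "r \<in> Cs ! j" "core_point Y e M r" "density_connected Y e M r q"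
    using dbscan_outputD(3,5)[OF out] j nth_mem[OF j(1)] by blast
  from r(3) obtain o' where o': "(directly_density_reachable Y e M)\<^sup>+\<^sup>+ o' r"
      "(directly_density_reachable Y e M)\<^sup>+\<^sup>+ o' q"
    unfolding density_connected_def using density_reachable_tranclp by blast
  obtain k where k: "k < length Cs" "o' \<in> Cs ! k"
    using dbscan_core_point_in_cluster[OF out tranclp_source_core_point[OF o'(1)]] .
  have "r \<in> Cs ! k"
    using dbscan_core_path_in_cluster[OF out k o'(1) r(2)] .
  then have "k = j"
    using dbscan_cluster_index_unique[OF out k(1) j(1)] r(1) by blast
  \<comment> \<open>the predecessor of \<open>q\<close> on its path from \<open>o'\<close>; it is \<open>o'\<close> itself if the path is one step\<close>
  obtain s where s: "directly_density_reachable Y e M s q" "s \<in> Cs ! j"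
    using o'(2)
  proof (cases rule: tranclp.cases)
    case r_into_trancl
    then show ?thesis using that k \<open>k = j\<close> by blast
  next
    case (trancl_into_trancl s)
    then have "s \<in> Cs ! k"
      using dbscan_core_path_in_cluster[OF out k] by (auto simp: directly_density_reachable_def)
    then show ?thesis using that trancl_into_trancl \<open>k = j\<close> by blast
  qed
  then have s': "core_point Y e M s" "q \<in> eps_nbhd Y e s"
    by (auto simp: directly_density_reachable_def)
  have "card (eps_nbhd Y e q) < M"
    using False q(2) by (auto simp: core_point_def)
  with nofree[of q] p q s' have "density_connected Y e M p s"
    unfolding free_border_point_def by blast
  then have "s \<in> Cs ! i"
    using dbscan_connected_core_points_same_cluster[OF out i _ p s'(1)] by blast
  then have "i = j"
    using dbscan_cluster_index_unique[OF out i(1) j(1)] s(2) by blast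
  with j show ?thesis by simp
qed

lemma dbscan_path_in_cluster:
  assumes out: "dbscan_output Y e M Cs" and nofree: "\<And>s. \<not> free_border_point Y e M s"
    and i: "i < length Cs" "p \<in> Cs ! i" and path: "(directly_density_reachable Y e M)\<^sup>+\<^sup>+ p q"
  shows "q \<in> Cs ! i"
  using path
  by (induction rule: tranclp_induct) (use dbscan_neighbour_in_cluster[OF out nofree i(1)] i(2) in blast)+

text \<open>
  A core point \<open>p\<close> of \<open>C\<close> stays core when the radius grows and so selects a cluster
  \<open>C'\<close> of the larger radius.  Any other point of \<open>C\<close> is reached from a common source
  with \<open>p\<close>, and the larger clusters are closed under reachability.  The cluster \<open>C'\<close> is unique
  because it is disjoint from all others and \<open>C\<close> is nonempty.
\<close>

lemma dbscan_cluster_nested: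
  assumes fin: "finite Y" and le: "e \<le> e'"
    and out: "dbscan_output Y e M Cs" and out': "dbscan_output Y e' M Cs'"
    and nofree: "\<And>s. \<not> free_border_point Y e' M s" and C: "C \<in> set Cs"
  shows "\<exists>!C'. C' \<in> set Cs' \<and> C \<subseteq> C'"
proof -
  obtain p where p: "p \<in> C" "core_point Y e M p"
    using dbscan_outputD(3)[OF out] C by blast
  obtain i where i: "i < length Cs'" "p \<in> Cs' ! i"
    using dbscan_core_point_in_cluster[OF out' core_point_mono[OF fin le p(2)]] .
  have path_mono: "(directly_density_reachable Y e' M)\<^sup>+\<^sup>+ x y"
    if "(directly_density_reachable Y e M)\<^sup>+\<^sup>+ x y" for x y
    using that
    by (induction rule: tranclp_induct)
       (blast intro: directly_density_reachable_mono[OF fin le] tranclp.intros)+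
  have "C \<subseteq> Cs' ! i"
  proof
    fix q assume "q \<in> C"
    then have "density_connected Y e M p q"
      using dbscan_outputD(5)[OF out] C p(1) by blast
    then obtain o' where o': "(directly_density_reachable Y e M)\<^sup>+\<^sup>+ o' p"
        "(directly_density_reachable Y e M)\<^sup>+\<^sup>+ o' q"
      unfolding density_connected_def using density_reachable_tranclp by blast
    obtain k where k: "k < length Cs'" "o' \<in> Cs' ! k"
      using dbscan_core_point_in_cluster[OF out'
          core_point_mono[OF fin le tranclp_source_core_point[OF o'(1)]]] .
    have "p \<in> Cs' ! k" "q \<in> Cs' ! k"
      using dbscan_path_in_cluster[OF out' nofree k] path_mono o' by blast+
    then show "q \<in> Cs' ! i"
      using dbscan_cluster_index_unique[OF out'] k i by blast
  qed
  moreover have "C' = Cs' ! i" if "C' \<in> set Cs'" "C \<subseteq> C'" for C'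
    using that p(1) i dbscan_cluster_index_unique[OF out' _ i(1)] by (metis in_set_conv_nth subsetD)
  ultimately show ?thesis using i(1) by (metis nth_mem)
qed

section \<open>Filtrations of cluster covers and of nerves\<close>

text \<open>
  Once the enclosing cluster is unique, functoriality is automatic: \<open>u i l\<close> and the
  composition of \<open>u i j\<close> with \<open>u j l\<close> both send \<open>C\<close> to a cluster at \<open>l\<close> that contains it.
\<close>

lemma nested_covers_filtration:
  fixes Cl :: "'i \<Rightarrow> 'b \<Rightarrow> 'a set list"
  assumes trans: "\<And>i j l. R i j \<Longrightarrow> R j l \<Longrightarrow> R i l"
    and nest: "\<And>i j b C. \<lbrakk>i \<in> T; j \<in> T; R i j; b \<in> J; C \<in> set (Cl i b)\<rbrakk> \<Longrightarrow>
                 \<exists>!C'. C' \<in> set (Cl j b) \<and> C \<subseteq> C'"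
  shows "\<exists>u. cover_filtration T R (\<lambda>i. cluster_cover J (Cl i)) (\<lambda>i. snd) u"
proof -
  define u where "u i j = (\<lambda>(b, C). (b, THE C'. C' \<in> set (Cl j b) \<and> C \<subseteq> C'))" for i j :: 'i
  have u_eq: "u i j (b, C) = (b, C')"
    if "i \<in> T" "j \<in> T" "R i j" "b \<in> J" "C \<in> set (Cl i b)" "C' \<in> set (Cl j b)" "C \<subseteq> C'" for i j b C C'
    unfolding u_def using the1_equality[OF nest[OF that(1-5)]] that(6,7) by simp
  have ex: "\<exists>C'. C' \<in> set (Cl j b) \<and> C \<subseteq> C' \<and> u i j (b, C) = (b, C')"
    if "i \<in> T" "j \<in> T" "R i j" "b \<in> J" "C \<in> set (Cl i b)" for i j b C
    using nest[OF that] u_eq[OF that] by blast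
  have "cover_filtration T R (\<lambda>i. cluster_cover J (Cl i)) (\<lambda>i. snd) u"
    unfolding cover_filtration_def cluster_cover_def
  proof (intro conjI ballI impI)
    fix i j assume ij: "i \<in> T" "j \<in> T" "R i j"
    show "u i j \<in> (SIGMA b:J. set (Cl i b)) \<rightarrow> (SIGMA b:J. set (Cl j b))"
      using ex[OF ij] by fastforce
    show "snd a \<subseteq> snd (u i j a)" if "a \<in> (SIGMA b:J. set (Cl i b))" for a
      using ex[OF ij] that by fastforce
  next
    fix i j l a
    assume T: "i \<in> T" "j \<in> T" "l \<in> T" and R: "R i j \<and> R j l" and a: "a \<in> (SIGMA b:J. set (Cl i b))"
    obtain b C where bC: "a = (b, C)" "b \<in> J" "C \<in> set (Cl i b)" using a by auto
    obtain C' where C': "C' \<in> set (Cl j b)" "C \<subseteq> C'" "u i j (b, C) = (b, C')"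
      using ex[OF T(1,2) conjunct1[OF R] bC(2,3)] by blast
    obtain C'' where C'': "C'' \<in> set (Cl l b)" "C' \<subseteq> C''" "u j l (b, C') = (b, C'')"
      using ex[OF T(2,3) conjunct2[OF R] bC(2) C'(1)] by blast
    have "u i l (b, C) = (b, C'')"
      using u_eq[OF T(1,3) _ bC(2,3) C''(1)] C' C'' trans R by blast
    then show "u j l (u i j a) = u i l a"
      using bC C' C'' by simp
  qed
  then show ?thesis by blast
qed

lemma simplicial_complex_nerve: "simplicial_complex (nerve A S)"
  unfolding simplicial_complex_def
proof (intro ballI conjI allI impI)
  fix s assume s: "s \<in> nerve A S"
  then show "finite s" "s \<noteq> {}" by (simp_all add: nerve_def)
  fix t assume t: "t \<subseteq> s \<and> t \<noteq> {}"
  have "(\<Inter>a\<in>s. S a) \<subseteq> (\<Inter>a\<in>t. S a)" using t by blast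
  then show "t \<in> nerve A S"
    using s t by (auto simp: nerve_def intro: finite_subset)
qed

text \<open>
  A point common to some sets is common to the larger sets that contain them, so the vertex maps
  take simplices to simplices.
\<close>

lemma cover_filtration_imp_nerve_filtration:
  assumes "cover_filtration T R A S u"
  shows "complex_filtration T R (\<lambda>i. nerve (A i) (S i)) u"
  unfolding complex_filtration_def
proof (intro conjI ballI impI)
  fix i j assume "i \<in> T" "j \<in> T" "R i j"
  then have u: "u i j a \<in> A j" "S i a \<subseteq> S j (u i j a)" if "a \<in> A i" for a
    using assms that unfolding cover_filtration_def by blast+
  show "simplicial_map (nerve (A i) (S i)) (nerve (A j) (S j)) (u i j)"
    unfolding simplicial_map_def
  proof
    fix s assume s: "s \<in> nerve (A i) (S i)"
    then have "s \<subseteq> A i" by (simp add: nerve_def)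
    then have "u i j ` s \<subseteq> A j" "(\<Inter>a\<in>s. S i a) \<subseteq> (\<Inter>b\<in>u i j ` s. S j b)"
      using u by fastforce+
    then show "u i j ` s \<in> nerve (A j) (S j)"
      using s by (auto simp: nerve_def)
  qed
next
  fix i j l v
  assume T: "i \<in> T" "j \<in> T" "l \<in> T" "R i j \<and> R j l" and "v \<in> \<Union> (nerve (A i) (S i))"
  then have "v \<in> A i" by (auto simp: nerve_def)
  with T assms show "u j l (u i j v) = u i l v"
    by (simp add: cover_filtration_def)
qed (rule simplicial_complex_nerve)

section \<open>Chains, boundaries and chain maps\<close>

text \<open>
  The boundary at \<open>w\<close> evaluates a chain at the lists \<open>x # w\<close>.  To see that it is again
  alternating, a permutation of \<open>w\<close> is extended by a fixed point in front, which keeps its sign.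
\<close>

lemma permutation_fixing_head:
  assumes "p permutes {..<length w}"
  obtains p' where "p' permutes {..<length (x # w)}" "evenperm p' = evenperm p"
    "permute_list p' (x # w) = x # permute_list p w"
proof -
  define p' where "p' = map_permutation {..<length w} Suc p"
  have img: "Suc ` {..<length w} \<subseteq> {..<length (x # w)}" by auto
  have perm: "p' permutes Suc ` {..<length w}"
    unfolding p'_def by (rule map_permutation_permutes[OF _ assms]) (auto simp: bij_betw_def)
  then have perm': "p' permutes {..<length (x # w)}"
    using img permutes_subset by blast
  have [simp]: "p' 0 = 0" using perm by (auto simp: permutes_def)
  have [simp]: "p' (Suc i) = Suc (p i)" if "i < length w" for i
    unfolding p'_def using that by (simp add: map_permutation_apply)
  have "[0..<length (x # w)] = 0 # map Suc [0..<length w]"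
    by (simp add: map_Suc_upt upt_conv_Cons del: upt_Suc)
  then have "permute_list p' (x # w) = x # permute_list p w"
    by (simp add: permute_list_def del: upt_Suc)
  moreover have "evenperm p' = evenperm p"
    unfolding p'_def by (rule evenperm_map_permutation) (use assms in auto)
  ultimately show ?thesis using that perm' by blast
qed

text \<open>
  Swapping the head with another entry is the only kind of transposition needed: it drives the
  cancellations both in the square of the boundary and in the naturality of the boundary.
\<close>

lemma permute_list_transpose_Cons:
  assumes "i < length w"
  shows "permute_list (transpose 0 (Suc i)) (x # w) = w ! i # w[i := x]"
proof (rule nth_equalityI)
  fix n assume "n < length (permute_list (transpose 0 (Suc i)) (x # w))"
  then have "permute_list (transpose 0 (Suc i)) (x # w) ! n = (x # w) ! transpose 0 (Suc i) n"
    by (simp add: permute_list_def del: upt_Suc)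
  then show "permute_list (transpose 0 (Suc i)) (x # w) ! n = (w ! i # w[i := x]) ! n"
    using assms by (cases n) (auto simp: transpose_def nth_list_update)
qed simp

context comm_group begin

lemma finprod_fibres:
  assumes "finite S" "finite T" "g ` S \<subseteq> T" "\<And>s. s \<in> S \<Longrightarrow> f s \<in> carrier G"
  shows "finprod G (\<lambda>t. finprod G f {s \<in> S. g s = t}) T = finprod G f S"
proof -
  have "S = (\<Union>t\<in>T. {s \<in> S. g s = t})" using assms(3) by blast
  then have "finprod G f S = finprod G f (\<Union>t\<in>T. {s \<in> S. g s = t})" by simp
  also have "\<dots> = finprod G (\<lambda>t. finprod G f {s \<in> S. g s = t}) T"
    by (rule finprod_UN_disjoint) (use assms in \<open>auto simp: pairwise_def disjnt_def\<close>)
  finally show ?thesis by simp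
qed

lemma finprod_inv:
  assumes "f \<in> A \<rightarrow> carrier G"
  shows "finprod G (\<lambda>x. inv (f x)) A = inv (finprod G f A)"
  using assms
  by (induction A rule: infinite_finite_induct) (auto simp: Pi_iff inv_mult)

text \<open>
  The terms cancel in pairs.  The involution may not have fixed points, since \<open>f s = inv (f s)\<close>
  does not force \<open>f s = \<one>\<close> in a group with 2-torsion.
\<close>

lemma finprod_sign_reversing_involution:
  assumes "finite S" and "\<And>s. s \<in> S \<Longrightarrow> f s \<in> carrier G"
    and "\<And>s. s \<in> S \<Longrightarrow> \<tau> s \<in> S \<and> \<tau> (\<tau> s) = s \<and> \<tau> s \<noteq> s \<and> f (\<tau> s) = inv (f s)"
  shows "finprod G f S = \<one>"
  using assms
proof (induction S rule: finite_psubset_induct)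
  case (psubset S)
  show ?case
  proof (cases "S = {}")
    case False
    then obtain s where s: "s \<in> S" by blast
    let ?S = "S - {s, \<tau> s}"
    have fin: "finite ?S" using psubset.hyps by blast
    have IH: "finprod G f ?S = \<one>"
    proof (rule psubset.IH)
      show "?S \<subset> S" using s by blast
      show "f t \<in> carrier G" if "t \<in> ?S" for t using psubset.prems(1) that by blast
      show "\<tau> t \<in> ?S \<and> \<tau> (\<tau> t) = t \<and> \<tau> t \<noteq> t \<and> f (\<tau> t) = inv (f t)" if "t \<in> ?S" for t
        using psubset.prems(2)[OF s] psubset.prems(2)[of t] that by auto
    qed
    have S: "S = insert s (insert (\<tau> s) ?S)" using s psubset.prems(2)[OF s] by blast
    have "finprod G f S = finprod G f (insert s (insert (\<tau> s) ?S))" using S by simp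
    also have "\<dots> = f s \<otimes> (f (\<tau> s) \<otimes> finprod G f ?S)"
      using fin s psubset.prems(1) psubset.prems(2)[OF s] by (subst finprod_insert; force)+
    also have "\<dots> = \<one>" using IH psubset.prems s by simp
    finally show ?thesis .
  qed simp
qed

lemma simplicial_chainsD:
  assumes "c \<in> simplicial_chains G K k"
  shows "c v \<in> carrier G" "finite {v. c v \<noteq> \<one>}"
    "c v \<noteq> \<one> \<Longrightarrow> int (length v) = k + 1" "c v \<noteq> \<one> \<Longrightarrow> distinct v" "c v \<noteq> \<one> \<Longrightarrow> set v \<in> K"
    "p permutes {..<length v} \<Longrightarrow> c (permute_list p v) = (if evenperm p then c v else inv (c v))"
  using assms unfolding simplicial_chains_def by auto

lemma simplicial_chain_group_comm_group: "comm_group (simplicial_chain_group G K k)"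
proof (rule comm_groupI)
  let ?C = "simplicial_chain_group G K k"
  fix c d assume cd: "c \<in> carrier ?C" "d \<in> carrier ?C"
  then have c: "c \<in> simplicial_chains G K k" and d: "d \<in> simplicial_chains G K k"
    by (simp_all add: simplicial_chain_group_def)
  note C = simplicial_chainsD[OF c] and D = simplicial_chainsD[OF d]
  have ne: "c v \<otimes> d v \<noteq> \<one> \<Longrightarrow> c v \<noteq> \<one> \<or> d v \<noteq> \<one>" for v by auto
  have "(\<lambda>v. c v \<otimes> d v) \<in> simplicial_chains G K k"
    unfolding simplicial_chains_def
  proof (intro CollectI conjI allI impI)
    show "finite {v. c v \<otimes> d v \<noteq> \<one>}"
      by (rule finite_subset[of _ "{v. c v \<noteq> \<one>} \<union> {v. d v \<noteq> \<one>}"]) (use C(2) D(2) in auto)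
  qed (use C D ne in \<open>auto simp: inv_mult\<close>, (metis ne)+)
  then show "c \<otimes>\<^bsub>?C\<^esub> d \<in> carrier ?C" by (simp add: simplicial_chain_group_def)
  show "c \<otimes>\<^bsub>?C\<^esub> d = d \<otimes>\<^bsub>?C\<^esub> c"
    by (auto simp: simplicial_chain_group_def C(1) D(1) m_comm)
  show "\<exists>d\<in>carrier ?C. d \<otimes>\<^bsub>?C\<^esub> c = \<one>\<^bsub>?C\<^esub>"
  proof (rule bexI[of _ "\<lambda>v. inv (c v)"])
    have "inv (c v) = \<one> \<longleftrightarrow> c v = \<one>" for v using C(1) by simp
    then show "(\<lambda>v. inv (c v)) \<in> carrier ?C"
      using C by (auto simp: simplicial_chain_group_def simplicial_chains_def)
  qed (use C(1) in \<open>simp add: simplicial_chain_group_def\<close>)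
  fix e assume "e \<in> carrier ?C"
  then have e: "e v \<in> carrier G" for v by (simp add: simplicial_chain_group_def simplicial_chains_def)
  show "(c \<otimes>\<^bsub>?C\<^esub> d) \<otimes>\<^bsub>?C\<^esub> e = c \<otimes>\<^bsub>?C\<^esub> (d \<otimes>\<^bsub>?C\<^esub> e)"
    using C(1) D(1) e by (auto simp: simplicial_chain_group_def m_assoc)
qed (auto simp: simplicial_chain_group_def simplicial_chains_def)

text \<open>
  The boundary is defined as a product over vertices, the chain map as a product over the
  support of the chain.  Both become products of \<open>c\<close> over part of one finite set \<open>A\<close> of
  lists, where \<open>A\<close> may exceed the support.  In this form products for different chains can be
  multiplied termwise, and iterated products can be regrouped by \<open>finprod_fibres\<close>.
\<close>

lemma simplicial_boundary_eq_finprod: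
  assumes "finite A" "\<And>v. c v \<noteq> \<one> \<Longrightarrow> v \<in> A" "\<And>v. c v \<in> carrier G" "w \<noteq> []"
  shows "simplicial_boundary G c w = finprod G c {v \<in> A. v \<noteq> [] \<and> tl v = w}"
proof -
  have "simplicial_boundary G c w = finprod G (\<lambda>x. c (x # w)) {x. c (x # w) \<noteq> \<one>}"
    using assms(4) by (simp add: simplicial_boundary_def)
  also have "\<dots> = finprod G c ((\<lambda>x. x # w) ` {x. c (x # w) \<noteq> \<one>})"
    by (rule finprod_reindex[symmetric]) (use assms(3) in \<open>auto simp: inj_on_def\<close>)
  also have "\<dots> = finprod G c {v \<in> A. v \<noteq> [] \<and> tl v = w}"
  proof (rule finprod_mono_neutral_cong_left)
    show "c v = \<one>" if "v \<in> {v \<in> A. v \<noteq> [] \<and> tl v = w} - (\<lambda>x. x # w) ` {x. c (x # w) \<noteq> \<one>}" for v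
      using that by (cases v) auto
  qed (use assms in auto)
  finally show ?thesis .
qed

lemma simplicial_chain_map_eq_finprod:
  assumes "finite A" "\<And>v. c v \<noteq> \<one> \<Longrightarrow> v \<in> A" "\<And>v. c v \<in> carrier G" "distinct w"
  shows "simplicial_chain_map G \<phi> c w = finprod G c {v \<in> A. map \<phi> v = w}"
proof -
  have "simplicial_chain_map G \<phi> c w = finprod G c {v. c v \<noteq> \<one> \<and> map \<phi> v = w}"
    using assms(4) by (simp add: simplicial_chain_map_def)
  also have "\<dots> = finprod G c {v \<in> A. map \<phi> v = w}"
    by (rule finprod_mono_neutral_cong_left) (use assms in auto)
  finally show ?thesis .
qed

lemma simplicial_boundary_neq_one:
  assumes "simplicial_boundary G c w \<noteq> \<one>"
  obtains x where "w \<noteq> []" "c (x # w) \<noteq> \<one>"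
  using assms unfolding simplicial_boundary_def
  by (metis (mono_tags, lifting) finprod_one_eqI mem_Collect_eq)

lemma simplicial_chain_map_neq_one:
  assumes "simplicial_chain_map G \<phi> c w \<noteq> \<one>"
  obtains v where "distinct w" "c v \<noteq> \<one>" "map \<phi> v = w"
  using assms unfolding simplicial_chain_map_def
  by (metis (mono_tags, lifting) finprod_one_eqI mem_Collect_eq)

lemma simplicial_boundary_closed:
  assumes "\<And>v. c v \<in> carrier G" shows "simplicial_boundary G c w \<in> carrier G"
  using assms by (simp add: simplicial_boundary_def)

lemma simplicial_chain_map_closed:
  assumes "\<And>v. c v \<in> carrier G" shows "simplicial_chain_map G \<phi> c w \<in> carrier G"
  using assms by (simp add: simplicial_chain_map_def)

lemma simplicial_boundary_in_chains:
  assumes K: "simplicial_complex K" and c: "c \<in> simplicial_chains G K k"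
  shows "simplicial_boundary G c \<in> simplicial_chains G K (k - 1)"
proof -
  note C = simplicial_chainsD[OF c]
  let ?d = "simplicial_boundary G c"
  have supp: "int (length w) = k - 1 + 1 \<and> distinct w \<and> set w \<in> K" if nz: "?d w \<noteq> \<one>" for w
  proof -
    obtain x where x: "w \<noteq> []" "c (x # w) \<noteq> \<one>"
      using simplicial_boundary_neq_one[OF nz] .
    have "set w \<subseteq> set (x # w)" "set w \<noteq> {}" using x(1) by auto
    then have "set w \<in> K"
      using C(5)[OF x(2)] K unfolding simplicial_complex_def by blast
    then show ?thesis using C(3,4)[OF x(2)] by simp
  qed
  have "{w. ?d w \<noteq> \<one>} \<subseteq> tl ` {v. c v \<noteq> \<one>}"
  proof
    fix w assume "w \<in> {w. ?d w \<noteq> \<one>}"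
    then obtain x where "c (x # w) \<noteq> \<one>" using simplicial_boundary_neq_one by blast
    then show "w \<in> tl ` {v. c v \<noteq> \<one>}" by force
  qed
  then have fin: "finite {w. ?d w \<noteq> \<one>}" using C(2) finite_surj by blast
  have alt: "?d (permute_list p w) = (if evenperm p then ?d w else inv (?d w))"
    if p: "p permutes {..<length w}" for p w
  proof (cases "w = []")
    case True
    then have "p = id" using p by simp
    then show ?thesis by simp
  next
    case False
    then have "permute_list p w \<noteq> []" by (metis length_0_conv length_permute_list)
    have flip: "c (x # permute_list p w) = (if evenperm p then c (x # w) else inv (c (x # w)))" for x
      using permutation_fixing_head[OF p, of x] C(6)[of _ "x # w"] by metis
    then have "c (x # permute_list p w) \<noteq> \<one> \<longleftrightarrow> c (x # w) \<noteq> \<one>" for x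
      using C(1) by auto
    then show ?thesis
      using False \<open>permute_list p w \<noteq> []\<close> C(1)
      by (simp add: simplicial_boundary_def flip finprod_inv)
  qed
  show ?thesis
    unfolding simplicial_chains_def
    using simplicial_boundary_closed[of c, OF C(1)] fin supp alt by simp
qed

lemma simplicial_chain_map_in_chains:
  assumes \<phi>: "simplicial_map K L \<phi>" and c: "c \<in> simplicial_chains G K k"
  shows "simplicial_chain_map G \<phi> c \<in> simplicial_chains G L k"
proof -
  note C = simplicial_chainsD[OF c]
  let ?d = "simplicial_chain_map G \<phi> c"
  have supp: "int (length w) = k + 1 \<and> distinct w \<and> set w \<in> L" if nz: "?d w \<noteq> \<one>" for w
  proof -
    obtain v where "distinct w" "c v \<noteq> \<one>" "map \<phi> v = w"
      using simplicial_chain_map_neq_one[OF nz] .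
    then show ?thesis
      using C(3,5)[of v] \<phi> unfolding simplicial_map_def by auto
  qed
  have "{w. ?d w \<noteq> \<one>} \<subseteq> map \<phi> ` {v. c v \<noteq> \<one>}"
    using simplicial_chain_map_neq_one by blast
  then have fin: "finite {w. ?d w \<noteq> \<one>}" using C(2) finite_surj by blast
  have alt: "?d (permute_list p w) = (if evenperm p then ?d w else inv (?d w))"
    if p: "p permutes {..<length w}" for p w
  proof (cases "distinct w")
    case False
    then show ?thesis using p by (simp add: simplicial_chain_map_def)
  next
    case True
    let ?V = "{v. c v \<noteq> \<one> \<and> map \<phi> v = w}"
    have len: "length v = length w" if "map \<phi> v = w" for v using that by auto
    have inv_p: "inv_into UNIV p permutes {..<length w}" using p permutes_inv by blast
    have inj: "inj_on (permute_list p) ?V"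
    proof (rule inj_on_inverseI)
      fix v assume "v \<in> ?V"
      then have "length v = length w" by auto
      then show "permute_list (inv_into UNIV p) (permute_list p v) = v"
        using p inv_p by (simp add: permute_list_compose[symmetric] permutes_inv_o)
    qed
    have ne: "c (permute_list p v) \<noteq> \<one> \<longleftrightarrow> c v \<noteq> \<one>" if "length v = length w" for v
      using C(1,6) p that by auto
    have "{v. c v \<noteq> \<one> \<and> map \<phi> v = permute_list p w} = permute_list p ` ?V"
    proof (intro equalityI subsetI)
      fix v assume v: "v \<in> {v. c v \<noteq> \<one> \<and> map \<phi> v = permute_list p w}"
      let ?u = "permute_list (inv_into UNIV p) v"
      have l: "length v = length w" using v by (metis (mono_tags, lifting) length_map length_permute_list mem_Collect_eq)
      have v_eq: "v = permute_list p ?u"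
        using p inv_p l by (simp add: permute_list_compose[symmetric] permutes_inv_o)
      have "map \<phi> ?u = permute_list (inv_into UNIV p) (permute_list p w)"
        using v l inv_p by (simp add: permute_list_map[symmetric])
      also have "\<dots> = w"
        using p inv_p by (simp add: permute_list_compose[symmetric] permutes_inv_o)
      finally show "v \<in> permute_list p ` ?V"
        using v v_eq ne[of ?u] l by (intro image_eqI[of _ _ ?u]) auto
    next
      fix v assume "v \<in> permute_list p ` ?V"
      then obtain u where u: "v = permute_list p u" "c u \<noteq> \<one>" "map \<phi> u = w" by blast
      then have "map \<phi> v = permute_list p w"
        using permute_list_map[of p u \<phi>] p len[of u] by simp
      then show "v \<in> {v. c v \<noteq> \<one> \<and> map \<phi> v = permute_list p w}"
        using ne[of u] u len[of u] by simp
    qed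
    then have "?d (permute_list p w) = finprod G c (permute_list p ` ?V)"
      using True p by (simp add: simplicial_chain_map_def)
    also have "\<dots> = finprod G (\<lambda>v. c (permute_list p v)) ?V"
      by (rule finprod_reindex[OF _ inj]) (use C(1) in auto)
    also have "\<dots> = finprod G (\<lambda>v. if evenperm p then c v else inv (c v)) ?V"
      by (rule finprod_cong') (use C(1) C(6)[of p] p len in auto)
    also have "\<dots> = (if evenperm p then ?d w else inv (?d w))"
      using True C(1) by (simp add: simplicial_chain_map_def finprod_inv)
    finally show ?thesis .
  qed
  show ?thesis
    unfolding simplicial_chains_def
    using simplicial_chain_map_closed[of c \<phi>, OF C(1)] fin supp alt by simp
qed

lemma simplicial_boundary_hom:
  assumes K: "simplicial_complex K"
  shows "simplicial_boundary G \<in> hom (simplicial_chain_group G K k) (simplicial_chain_group G K (k - 1))"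
proof (rule homI)
  fix c d assume "c \<in> carrier (simplicial_chain_group G K k)" "d \<in> carrier (simplicial_chain_group G K k)"
  then have c: "c \<in> simplicial_chains G K k" and d: "d \<in> simplicial_chains G K k"
    by (simp_all add: simplicial_chain_group_def)
  note C = simplicial_chainsD[OF c] and D = simplicial_chainsD[OF d]
  define A where "A = {v. c v \<noteq> \<one>} \<union> {v. d v \<noteq> \<one>}"
  have A: "finite A" using C(2) D(2) by (simp add: A_def)
  have eq: "simplicial_boundary G f w = finprod G f {v \<in> A. v \<noteq> [] \<and> tl v = w}"
    if "\<And>v. v \<notin> A \<Longrightarrow> f v = \<one>" "\<And>v. f v \<in> carrier G" "w \<noteq> []" for f w
    using that by (intro simplicial_boundary_eq_finprod[OF A]) auto
  have "simplicial_boundary G (\<lambda>v. c v \<otimes> d v) w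
      = simplicial_boundary G c w \<otimes> simplicial_boundary G d w" for w
  proof (cases "w = []")
    case False
    have "simplicial_boundary G (\<lambda>v. c v \<otimes> d v) w
        = finprod G (\<lambda>v. c v \<otimes> d v) {v \<in> A. v \<noteq> [] \<and> tl v = w}"
      by (rule eq) (use C(1) D(1) False in \<open>auto simp: A_def\<close>)
    moreover have "simplicial_boundary G c w = finprod G c {v \<in> A. v \<noteq> [] \<and> tl v = w}"
      by (rule eq) (use C(1) False in \<open>auto simp: A_def\<close>)
    moreover have "simplicial_boundary G d w = finprod G d {v \<in> A. v \<noteq> [] \<and> tl v = w}"
      by (rule eq) (use D(1) False in \<open>auto simp: A_def\<close>)
    ultimately show ?thesis
      using C(1) D(1) by simp
  qed (simp add: simplicial_boundary_def)
  then show "simplicial_boundary G (c \<otimes>\<^bsub>simplicial_chain_group G K k\<^esub> d)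
     = simplicial_boundary G c \<otimes>\<^bsub>simplicial_chain_group G K (k - 1)\<^esub> simplicial_boundary G d"
    by (auto simp: simplicial_chain_group_def)
qed (auto simp: simplicial_chain_group_def intro: simplicial_boundary_in_chains[OF K])

lemma simplicial_chain_map_hom:
  assumes \<phi>: "simplicial_map K L \<phi>"
  shows "simplicial_chain_map G \<phi> \<in> hom (simplicial_chain_group G K k) (simplicial_chain_group G L k)"
proof (rule homI)
  fix c d assume "c \<in> carrier (simplicial_chain_group G K k)" "d \<in> carrier (simplicial_chain_group G K k)"
  then have c: "c \<in> simplicial_chains G K k" and d: "d \<in> simplicial_chains G K k"
    by (simp_all add: simplicial_chain_group_def)
  note C = simplicial_chainsD[OF c] and D = simplicial_chainsD[OF d]
  define A where "A = {v. c v \<noteq> \<one>} \<union> {v. d v \<noteq> \<one>}"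
  have A: "finite A" using C(2) D(2) by (simp add: A_def)
  have eq: "simplicial_chain_map G \<phi> f w = finprod G f {v \<in> A. map \<phi> v = w}"
    if "\<And>v. v \<notin> A \<Longrightarrow> f v = \<one>" "\<And>v. f v \<in> carrier G" "distinct w" for f w
    using that by (intro simplicial_chain_map_eq_finprod[OF A]) auto
  have "simplicial_chain_map G \<phi> (\<lambda>v. c v \<otimes> d v) w
      = simplicial_chain_map G \<phi> c w \<otimes> simplicial_chain_map G \<phi> d w" for w
  proof (cases "distinct w")
    case True
    have "simplicial_chain_map G \<phi> (\<lambda>v. c v \<otimes> d v) w
        = finprod G (\<lambda>v. c v \<otimes> d v) {v \<in> A. map \<phi> v = w}"
      by (rule eq) (use C(1) D(1) True in \<open>auto simp: A_def\<close>)
    moreover have "simplicial_chain_map G \<phi> c w = finprod G c {v \<in> A. map \<phi> v = w}"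
      by (rule eq) (use C(1) True in \<open>auto simp: A_def\<close>)
    moreover have "simplicial_chain_map G \<phi> d w = finprod G d {v \<in> A. map \<phi> v = w}"
      by (rule eq) (use D(1) True in \<open>auto simp: A_def\<close>)
    ultimately show ?thesis
      using C(1) D(1) by simp
  qed (simp add: simplicial_chain_map_def)
  then show "simplicial_chain_map G \<phi> (c \<otimes>\<^bsub>simplicial_chain_group G K k\<^esub> d)
     = simplicial_chain_map G \<phi> c \<otimes>\<^bsub>simplicial_chain_group G L k\<^esub> simplicial_chain_map G \<phi> d"
    by (auto simp: simplicial_chain_group_def)
qed (auto simp: simplicial_chain_group_def intro: simplicial_chain_map_in_chains[OF \<phi>])

lemma simplicial_chain_transpose:
  assumes c: "c \<in> simplicial_chains G K k" and v: "c v \<noteq> \<one>"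
    and ij: "i < length v" "j < length v" "i \<noteq> j"
  shows "c (permute_list (transpose i j) v) = inv (c v)"
    and "permute_list (transpose i j) (permute_list (transpose i j) v) = v"
    and "permute_list (transpose i j) v \<noteq> v"
proof -
  have p: "transpose i j permutes {..<length v}"
    using ij by (auto intro: permutes_swap_id)
  show "c (permute_list (transpose i j) v) = inv (c v)"
    using simplicial_chainsD(6)[OF c p] ij by (simp add: evenperm_swap)
  show "permute_list (transpose i j) (permute_list (transpose i j) v) = v"
    using p by (simp add: permute_list_compose[symmetric])
  have "permute_list (transpose i j) v ! i = v ! j"
    using permute_list_nth[OF p ij(1)] by simp
  moreover have "v ! j \<noteq> v ! i"
    using simplicial_chainsD(4)[OF c v] ij by (simp add: nth_eq_iff_index_eq)
  ultimately show "permute_list (transpose i j) v \<noteq> v" by metis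
qed

text \<open>
  The value at \<open>w\<close> is the product of \<open>c\<close> over all lists \<open>x # y # w\<close> in its support.
  Exchanging \<open>x\<close> and \<open>y\<close> pairs each factor with its inverse.
\<close>

lemma simplicial_boundary_boundary:
  assumes K: "simplicial_complex K" and c: "c \<in> simplicial_chains G K k"
  shows "simplicial_boundary G (simplicial_boundary G c) w = \<one>"
proof (cases "w = []")
  case True
  then show ?thesis by (simp add: simplicial_boundary_def)
next
  case w: False
  note C = simplicial_chainsD[OF c]
  let ?A = "{v. c v \<noteq> \<one>}"
  let ?d = "simplicial_boundary G c"
  let ?T = "{u \<in> tl ` ?A. u \<noteq> [] \<and> tl u = w}"
  let ?S = "{v \<in> ?A. v \<noteq> [] \<and> tl v \<noteq> [] \<and> tl (tl v) = w}"
  have supp: "u \<in> tl ` ?A" if "?d u \<noteq> \<one>" for u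
    using simplicial_boundary_neq_one[OF that] by (metis (mono_tags, lifting) imageI list.sel(3) mem_Collect_eq)
  have "simplicial_boundary G ?d w = finprod G ?d ?T"
    using C(1,2) w supp simplicial_boundary_closed[of c, OF C(1)]
    by (intro simplicial_boundary_eq_finprod) auto
  also have "\<dots> = finprod G (\<lambda>u. finprod G c {v \<in> ?S. tl v = u}) ?T"
  proof (rule finprod_cong')
    fix u assume u: "u \<in> ?T"
    then have "?d u = finprod G c {v \<in> ?A. v \<noteq> [] \<and> tl v = u}"
      using C(1,2) by (intro simplicial_boundary_eq_finprod) auto
    moreover have "{v \<in> ?A. v \<noteq> [] \<and> tl v = u} = {v \<in> ?S. tl v = u}" using u by blast
    ultimately show "?d u = finprod G c {v \<in> ?S. tl v = u}" by simp
  qed (use C(1) in auto)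
  also have "\<dots> = finprod G c ?S"
    by (rule finprod_fibres) (use C(1,2) in auto)
  also have "\<dots> = \<one>"
  proof (rule finprod_sign_reversing_involution[where \<tau> = "permute_list (transpose 0 1)"])
    fix v assume v: "v \<in> ?S"
    then have "v \<noteq> []" "tl v \<noteq> []" by auto
    then obtain x y z where vv: "v = x # y # z" by (metis list.exhaust_sel)
    have sw: "permute_list (transpose 0 1) v = y # x # z"
      using permute_list_transpose_Cons[of 0 "y # z" x] by (simp add: vv)
    have nz: "c v \<noteq> \<one>" using v by blast
    have ij: "0 < length v" "1 < length v" "0 \<noteq> (1::nat)" using vv by auto
    note tr = simplicial_chain_transpose[OF c nz ij]
    have "c (permute_list (transpose 0 1) v) \<noteq> \<one>" using tr(1) nz C(1) by simp
    then have "permute_list (transpose 0 1) v \<in> ?S"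
      using v vv unfolding sw by auto
    with tr show "permute_list (transpose 0 1) v \<in> ?S \<and>
        permute_list (transpose 0 1) (permute_list (transpose 0 1) v) = v \<and>
        permute_list (transpose 0 1) v \<noteq> v \<and> c (permute_list (transpose 0 1) v) = inv (c v)"
      by blast
  qed (use C(1,2) in auto)
  finally show ?thesis .
qed

text \<open>
  Let \<open>w\<close> be nonempty and without repetitions; otherwise both sides are trivial.
  On the right-hand side stands the product of \<open>c\<close> over all \<open>x # v\<close> with
  \<open>map \<phi> v = w\<close>; on the left-hand side only those with \<open>\<phi> x \<notin> set w\<close> occur, because
  degenerate images count as trivial.  In each of the remaining lists, \<open>\<phi> x\<close> equals exactly one
  entry of \<open>w\<close>, and exchanging \<open>x\<close> with the entry of \<open>v\<close> at that position keeps the image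
  but inverts the value of \<open>c\<close>.  These factors therefore cancel.
\<close>

lemma simplicial_boundary_chain_map:
  assumes c: "c \<in> simplicial_chains G K k"
  shows "simplicial_boundary G (simplicial_chain_map G \<phi> c) w
       = simplicial_chain_map G \<phi> (simplicial_boundary G c) w"
proof (cases "w \<noteq> [] \<and> distinct w")
  case False
  then consider "w = []" | "\<not> distinct w" by blast
  then show ?thesis
  proof cases
    case 1
    have "simplicial_chain_map G \<phi> (simplicial_boundary G c) [] = \<one>"
      using simplicial_chain_map_neq_one[of \<phi> "simplicial_boundary G c" "[]"]
        simplicial_boundary_neq_one[of c "[]"] by fastforce
    with 1 show ?thesis by (simp add: simplicial_boundary_def)
  next
    case 2
    then have "simplicial_boundary G (simplicial_chain_map G \<phi> c) w = \<one>"
      using simplicial_boundary_neq_one[of "simplicial_chain_map G \<phi> c" w]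
        simplicial_chain_map_neq_one[of \<phi> c] by (metis distinct.simps(2))
    with 2 show ?thesis by (simp add: simplicial_chain_map_def)
  qed
next
  case w: True
  note C = simplicial_chainsD[OF c]
  let ?A = "{v. c v \<noteq> \<one>}"
  let ?S = "{v \<in> ?A. v \<noteq> [] \<and> map \<phi> (tl v) = w}"
  let ?P = "{v \<in> ?S. \<phi> (hd v) \<notin> set w}"
  let ?Q = "{v \<in> ?S. \<phi> (hd v) \<in> set w}"
  have finA: "finite ?A" by (rule C(2))
  let ?d = "simplicial_boundary G c" and ?m = "simplicial_chain_map G \<phi> c"

  let ?T = "{u \<in> tl ` ?A. map \<phi> u = w}"
  have supp: "u \<in> tl ` ?A" if "?d u \<noteq> \<one>" for u
    using simplicial_boundary_neq_one[OF that] by (metis (mono_tags, lifting) imageI list.sel(3) mem_Collect_eq)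
  have "simplicial_chain_map G \<phi> ?d w = finprod G ?d ?T"
    using finA w supp simplicial_boundary_closed[of c, OF C(1)]
    by (intro simplicial_chain_map_eq_finprod) auto
  also have "\<dots> = finprod G (\<lambda>u. finprod G c {v \<in> ?S. tl v = u}) ?T"
  proof (rule finprod_cong')
    fix u assume u: "u \<in> ?T"
    then have "?d u = finprod G c {v \<in> ?A. v \<noteq> [] \<and> tl v = u}"
      using C(1) finA w by (intro simplicial_boundary_eq_finprod) auto
    moreover have "{v \<in> ?A. v \<noteq> [] \<and> tl v = u} = {v \<in> ?S. tl v = u}" using u by blast
    ultimately show "?d u = finprod G c {v \<in> ?S. tl v = u}" by simp
  qed (use C(1) in auto)
  also have "\<dots> = finprod G c ?S"
    by (rule finprod_fibres) (use C(1) finA in auto)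
  also have "\<dots> = finprod G c (?P \<union> ?Q)" by (rule arg_cong[of _ _ "finprod G c"]) blast
  also have "\<dots> = finprod G c ?P \<otimes> finprod G c ?Q"
    by (rule finprod_Un_disjoint) (use C(1) finA in auto)
  \<comment> \<open>the degenerate part cancels in pairs\<close>
  also have "finprod G c ?Q = \<one>"
  proof -
    define \<tau> where "\<tau> v = permute_list (transpose 0 (Suc (THE i. i < length w \<and> w ! i = \<phi> (hd v)))) v" for v
    have \<tau>: "\<tau> v \<in> ?Q \<and> \<tau> (\<tau> v) = v \<and> \<tau> v \<noteq> v \<and> c (\<tau> v) = inv (c v)" if v: "v \<in> ?Q" for v
    proof -
      have nz: "c v \<noteq> \<one>" using v by blast
      obtain x z where vx: "v = x # z" using v by (cases v) auto
      have z: "map \<phi> z = w" "\<phi> x \<in> set w" using v vx by auto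
      then obtain i where i: "i < length w" "w ! i = \<phi> x" by (auto simp: in_set_conv_nth)
      have the_i: "(THE i. i < length w \<and> w ! i = \<phi> x) = i"
        by (rule the_equality) (use w i in \<open>auto simp flip: nth_eq_iff_index_eq[of w]\<close>)
      have lz: "length z = length w" using z(1) by auto
      have tv: "\<tau> v = permute_list (transpose 0 (Suc i)) v"
        unfolding \<tau>_def using the_i vx by simp
      have sw: "\<tau> v = z ! i # z[i := x]"
        unfolding tv unfolding vx using i lz by (simp add: permute_list_transpose_Cons)
      have \<phi>zi: "\<phi> (z ! i) = \<phi> x" using z(1) i lz by (metis nth_map)
      have ij: "0 < length v" "Suc i < length v" "0 \<noteq> Suc i" using vx lz i by auto
      note tr = simplicial_chain_transpose[OF c nz ij]
      have "c (\<tau> v) \<noteq> \<one>" unfolding tv using tr(1) nz C(1) by simp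
      moreover have "map \<phi> (z[i := x]) = w"
        using z(1) i by (metis list_update_id map_update)
      ultimately have "\<tau> v \<in> ?Q"
        using z \<phi>zi unfolding sw by auto
      moreover have "\<tau> (\<tau> v) = permute_list (transpose 0 (Suc i)) (\<tau> v)"
        unfolding \<tau>_def[of "\<tau> v"] using \<phi>zi the_i by (simp add: sw)
      ultimately show ?thesis using tr tv by simp
    qed
    show ?thesis
      by (rule finprod_sign_reversing_involution[of _ _ \<tau>]) (use finA C(1) \<tau> in auto)
  qed
  also have "finprod G c ?P \<otimes> \<one> = finprod G c ?P" using C(1) by simp
  finally have R: "simplicial_chain_map G \<phi> ?d w = finprod G c ?P" .

  let ?B = "map \<phi> ` ?A"
  let ?U = "{u \<in> ?B. u \<noteq> [] \<and> tl u = w}"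
  have "u \<in> ?B" if nz: "?m u \<noteq> \<one>" for u
    using simplicial_chain_map_neq_one[OF nz] by blast
  then have "simplicial_boundary G ?m w = finprod G ?m ?U"
    using w finA simplicial_chain_map_closed[of c \<phi>, OF C(1)]
    by (intro simplicial_boundary_eq_finprod) simp_all
  also have "\<dots> = finprod G ?m {u \<in> ?U. hd u \<notin> set w}"
  proof (rule finprod_mono_neutral_cong_right)
    show "?m u = \<one>" if "u \<in> ?U - {u \<in> ?U. hd u \<notin> set w}" for u
    proof -
      have "u \<noteq> []" "tl u = w" "hd u \<in> set w" using that by blast+
      then have "\<not> distinct u" by (cases u) auto
      then show ?thesis by (simp add: simplicial_chain_map_def)
    qed
  qed (use finA simplicial_chain_map_closed[of c \<phi>, OF C(1)] in auto)
  also have "\<dots> = finprod G (\<lambda>u. finprod G c {v \<in> ?P. map \<phi> v = u}) {u \<in> ?U. hd u \<notin> set w}"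
  proof (rule finprod_cong')
    fix u assume u: "u \<in> {u \<in> ?U. hd u \<notin> set w}"
    then have "u \<noteq> []" "tl u = w" "hd u \<notin> set w" by blast+
    then have "distinct u" using w by (cases u) auto
    then have "?m u = finprod G c {v \<in> ?A. map \<phi> v = u}"
      using C(1) finA by (intro simplicial_chain_map_eq_finprod) auto
    moreover have "v \<noteq> [] \<and> map \<phi> (tl v) = w \<and> \<phi> (hd v) \<notin> set w" if "map \<phi> v = u" for v
      using u that by (cases v) auto
    then have "{v \<in> ?A. map \<phi> v = u} = {v \<in> ?P. map \<phi> v = u}" by blast
    ultimately show "?m u = finprod G c {v \<in> ?P. map \<phi> v = u}" by simp
  qed (use C(1) in auto)
  also have "\<dots> = finprod G c ?P"
  proof (rule finprod_fibres)
    show "map \<phi> ` ?P \<subseteq> {u \<in> ?U. hd u \<notin> set w}"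
      by (auto simp: list.map_sel)
  qed (use C(1) finA in auto)
  finally show ?thesis using R by simp
qed

text \<open>
  The identity is exact already on chains: a list that \<open>\<phi>\<close> maps to a list with repetitions,
  and which is therefore lost on the left, is mapped to one with repetitions by \<open>\<chi>\<close> as well.
  Agreement of the vertex maps is required on the vertices of \<open>K\<close> only, as this is all that a
  filtration provides.
\<close>

lemma simplicial_chain_map_comp:
  assumes c: "c \<in> simplicial_chains G K k" and comp: "\<And>v. v \<in> \<Union> K \<Longrightarrow> \<psi> (\<phi> v) = \<chi> v"
  shows "simplicial_chain_map G \<psi> (simplicial_chain_map G \<phi> c) = simplicial_chain_map G \<chi> c"
proof
  fix w
  note C = simplicial_chainsD[OF c]
  let ?A = "{v. c v \<noteq> \<one>}" and ?m = "simplicial_chain_map G \<phi> c"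
  have map_\<chi>: "map \<chi> v = map \<psi> (map \<phi> v)" if "v \<in> ?A" for v
    using C(5)[of v] that by (auto intro!: comp[symmetric])
  show "simplicial_chain_map G \<psi> ?m w = simplicial_chain_map G \<chi> c w"
  proof (cases "distinct w")
    case True
    let ?T = "{u \<in> map \<phi> ` ?A. map \<psi> u = w}" and ?S = "{v \<in> ?A. map \<chi> v = w}"
    have "u \<in> map \<phi> ` ?A" if nz: "?m u \<noteq> \<one>" for u
      using simplicial_chain_map_neq_one[OF nz] by blast
    then have "simplicial_chain_map G \<psi> ?m w = finprod G ?m ?T"
      using True C(2) simplicial_chain_map_closed[of c \<phi>, OF C(1)]
      by (intro simplicial_chain_map_eq_finprod) simp_all
    also have "\<dots> = finprod G (\<lambda>u. finprod G c {v \<in> ?S. map \<phi> v = u}) ?T"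
    proof (rule finprod_cong')
      fix u assume u: "u \<in> ?T"
      then have "distinct u" using True distinct_map by blast
      then have "?m u = finprod G c {v \<in> ?A. map \<phi> v = u}"
        using C(1,2) by (intro simplicial_chain_map_eq_finprod) auto
      moreover have "{v \<in> ?A. map \<phi> v = u} = {v \<in> ?S. map \<phi> v = u}"
        using u map_\<chi> by (smt (verit) Collect_cong mem_Collect_eq)
      ultimately show "?m u = finprod G c {v \<in> ?S. map \<phi> v = u}" by simp
    qed (use C(1) in auto)
    also have "\<dots> = finprod G c ?S"
      by (rule finprod_fibres) (use C(1,2) map_\<chi> in auto)
    also have "\<dots> = simplicial_chain_map G \<chi> c w"
      by (rule simplicial_chain_map_eq_finprod[symmetric]) (use C True in auto)
    finally show ?thesis .
  qed (simp add: simplicial_chain_map_def)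
qed

section \<open>Homology and induced homomorphisms\<close>

lemma group_hom_boundary:
  assumes "simplicial_complex K"
  shows "group_hom (simplicial_chain_group G K k) (simplicial_chain_group G K (k - 1))
           (simplicial_boundary G)"
  by (intro group_hom.intro group_hom_axioms.intro comm_group.axioms(2)
      simplicial_chain_group_comm_group simplicial_boundary_hom assms)

lemma simplicial_cyclesD:
  assumes "c \<in> simplicial_cycles G K k"
  shows "c \<in> simplicial_chains G K k" "simplicial_boundary G c = (\<lambda>v. \<one>)"
  using assms by (auto simp: simplicial_cycles_def kernel_def simplicial_chain_group_def)

lemma simplicial_cycles_subgroup:
  assumes "simplicial_complex K"
  shows "subgroup (simplicial_cycles G K k) (simplicial_chain_group G K k)"
  unfolding simplicial_cycles_def by (rule group_hom.subgroup_kernel[OF group_hom_boundary[OF assms]])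

lemma simplicial_boundaries_normal:
  assumes K: "simplicial_complex K"
  shows "simplicial_boundaries G K k \<lhd>
           (simplicial_chain_group G K k)\<lparr>carrier := simplicial_cycles G K k\<rparr>"
proof -
  interpret C: comm_group "simplicial_chain_group G K k" by (rule simplicial_chain_group_comm_group)
  have "subgroup (simplicial_boundaries G K k) (simplicial_chain_group G K k)"
    using group_hom.img_is_subgroup[OF group_hom_boundary[OF K, of "k + 1"]]
    by (simp add: simplicial_boundaries_def simplicial_chain_group_def)
  moreover have "simplicial_boundaries G K k \<subseteq> simplicial_cycles G K k"
    using simplicial_boundary_in_chains[OF K, of _ "k + 1"] simplicial_boundary_boundary[OF K, of _ "k + 1"]
    by (auto simp: simplicial_boundaries_def simplicial_cycles_def kernel_def simplicial_chain_group_def)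
  ultimately have "simplicial_boundaries G K k \<lhd> simplicial_chain_group G K k"
     "simplicial_boundaries G K k \<subseteq> simplicial_cycles G K k"
    by (auto intro: C.subgroup_imp_normal)
  then show ?thesis
    using C.normal_restrict_supergroup[OF simplicial_cycles_subgroup[OF K]] by blast
qed

lemma simplicial_homology_group:
  "simplicial_complex K \<Longrightarrow> group (simplicial_homology G K k)"
  unfolding simplicial_homology_def by (rule normal.factorgroup_is_group[OF simplicial_boundaries_normal])

lemma homology_class_eq_rcoset:
  "homology_class G K k c = simplicial_boundaries G K k
     #>\<^bsub>(simplicial_chain_group G K k)\<lparr>carrier := simplicial_cycles G K k\<rparr>\<^esub> c"
  by (simp add: homology_class_def r_coset_def)

lemma carrier_simplicial_homology:
  "carrier (simplicial_homology G K k) = homology_class G K k ` simplicial_cycles G K k"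
  by (auto simp: simplicial_homology_def carrier_FactGroup homology_class_eq_rcoset)

lemma simplicial_chain_map_cycle:
  assumes "simplicial_map K L \<phi>" "c \<in> simplicial_cycles G K k"
  shows "simplicial_chain_map G \<phi> c \<in> simplicial_cycles G L k"
proof -
  note c = simplicial_cyclesD[OF assms(2)]
  have "simplicial_boundary G (simplicial_chain_map G \<phi> c) w = \<one>" for w
    using simplicial_boundary_chain_map[OF c(1), of \<phi> w] c(2)
    by (simp add: simplicial_chain_map_def)
  then show ?thesis
    using simplicial_chain_map_in_chains[OF assms(1) c(1)]
    by (auto simp: simplicial_cycles_def kernel_def simplicial_chain_group_def)
qed

lemma simplicial_chain_map_boundary:
  assumes "simplicial_map K L \<phi>" "b \<in> simplicial_boundaries G K k"
  shows "simplicial_chain_map G \<phi> b \<in> simplicial_boundaries G L k"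
proof -
  obtain c where c: "c \<in> simplicial_chains G K (k + 1)" "b = simplicial_boundary G c"
    using assms(2) by (auto simp: simplicial_boundaries_def)
  have "simplicial_chain_map G \<phi> b = simplicial_boundary G (simplicial_chain_map G \<phi> c)"
    using simplicial_boundary_chain_map[OF c(1), of \<phi>] c(2) by auto
  then show ?thesis
    using simplicial_chain_map_in_chains[OF assms(1) c(1)] by (simp add: simplicial_boundaries_def)
qed

text \<open>
  The chain map sends cycles to cycles and boundaries to boundaries, so the map from cycles to
  classes in the target is constant on cosets and factors through the quotient.
\<close>

lemma ex_induced_on_homology:
  assumes K: "simplicial_complex K" and L: "simplicial_complex L" and \<phi>: "simplicial_map K L \<phi>"
  shows "\<exists>f. f \<in> hom (simplicial_homology G K k) (simplicial_homology G L k) \<and>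
             induced_on_homology G K L k \<phi> f"
proof -
  let ?Z = "\<lambda>K. (simplicial_chain_group G K k)\<lparr>carrier := simplicial_cycles G K k\<rparr>"
  let ?h = "simplicial_chain_map G \<phi>"
  interpret N: normal "simplicial_boundaries G K k" "?Z K" by (rule simplicial_boundaries_normal[OF K])
  interpret M: normal "simplicial_boundaries G L k" "?Z L" by (rule simplicial_boundaries_normal[OF L])
  have h: "?h \<in> hom (?Z K) (?Z L)"
  proof (rule homI)
    fix c d assume "c \<in> carrier (?Z K)" "d \<in> carrier (?Z K)"
    then have "c \<in> carrier (simplicial_chain_group G K k)" "d \<in> carrier (simplicial_chain_group G K k)"
      using simplicial_cyclesD(1) by (auto simp: simplicial_chain_group_def)
    then show "?h (c \<otimes>\<^bsub>?Z K\<^esub> d) = ?h c \<otimes>\<^bsub>?Z L\<^esub> ?h d"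
      using hom_mult[OF simplicial_chain_map_hom[OF \<phi>]] by simp
  qed (use simplicial_chain_map_cycle[OF \<phi>] in auto)
  have comp: "(\<lambda>c. simplicial_boundaries G L k #>\<^bsub>?Z L\<^esub> c) \<circ> ?h \<in> hom (?Z K) (simplicial_homology G L k)"
    unfolding simplicial_homology_def by (rule Group.hom_compose[OF h M.r_coset_hom_Mod])
  obtain f where f: "f \<in> hom (simplicial_homology G K k) (simplicial_homology G L k)"
    "\<And>c. c \<in> carrier (?Z K) \<Longrightarrow> f (simplicial_boundaries G K k #>\<^bsub>?Z K\<^esub> c)
        = ((\<lambda>c. simplicial_boundaries G L k #>\<^bsub>?Z L\<^esub> c) \<circ> ?h) c"
  proof (rule FactGroup_universal[OF comp simplicial_boundaries_normal[OF K]])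
    fix c d assume cd: "c \<in> carrier (?Z K)" "d \<in> carrier (?Z K)"
      "simplicial_boundaries G K k #>\<^bsub>?Z K\<^esub> c = simplicial_boundaries G K k #>\<^bsub>?Z K\<^esub> d"
    have "c \<in> simplicial_boundaries G K k #>\<^bsub>?Z K\<^esub> d"
      using N.rcos_self[OF cd(1) N.subgroup_axioms] cd(3) by simp
    then obtain b where b: "b \<in> simplicial_boundaries G K k" "c = b \<otimes>\<^bsub>?Z K\<^esub> d"
      by (auto simp: r_coset_def)
    then have "?h c = ?h b \<otimes>\<^bsub>?Z L\<^esub> ?h d"
      using hom_mult[OF h] N.mem_carrier cd(2) by blast
    moreover have "?h b \<in> simplicial_boundaries G L k"
      using simplicial_chain_map_boundary[OF \<phi> b(1)] .
    moreover have "?h d \<in> carrier (?Z L)" using hom_in_carrier[OF h cd(2)] .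
    ultimately have "?h c \<in> simplicial_boundaries G L k #>\<^bsub>?Z L\<^esub> ?h d"
      by (auto simp: r_coset_def)
    then show "((\<lambda>c. simplicial_boundaries G L k #>\<^bsub>?Z L\<^esub> c) \<circ> ?h) c
        = ((\<lambda>c. simplicial_boundaries G L k #>\<^bsub>?Z L\<^esub> c) \<circ> ?h) d"
      using M.repr_independence[OF _ \<open>?h d \<in> carrier (?Z L)\<close> M.subgroup_axioms] by simp
  qed (simp_all add: simplicial_homology_def)
  then have "induced_on_homology G K L k \<phi> f"
    by (simp add: induced_on_homology_def homology_class_eq_rcoset)
  with f(1) show ?thesis by blast
qed

lemma complex_filtration_imp_homology_filtration:
  assumes filt: "complex_filtration T R K \<phi>" and trans: "\<And>i j l. R i j \<Longrightarrow> R j l \<Longrightarrow> R i l"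
  shows "\<exists>f. group_filtration T R (\<lambda>i. simplicial_homology G (K i) k) f \<and>
             (\<forall>i\<in>T. \<forall>j\<in>T. R i j \<longrightarrow> induced_on_homology G (K i) (K j) k (\<phi> i j) (f i j))"
proof -
  have K: "simplicial_complex (K i)" if "i \<in> T" for i
    using filt that unfolding complex_filtration_def by blast
  have \<phi>: "simplicial_map (K i) (K j) (\<phi> i j)" if "i \<in> T" "j \<in> T" "R i j" for i j
    using filt that unfolding complex_filtration_def by blast
  have "\<exists>f. \<forall>i j. i \<in> T \<and> j \<in> T \<and> R i j \<longrightarrow>
      f i j \<in> hom (simplicial_homology G (K i) k) (simplicial_homology G (K j) k) \<and>
      induced_on_homology G (K i) (K j) k (\<phi> i j) (f i j)"
    using ex_induced_on_homology[OF K K \<phi>] by (intro choice allI) metis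
  then obtain f where f: "\<And>i j. \<lbrakk>i \<in> T; j \<in> T; R i j\<rbrakk> \<Longrightarrow>
      f i j \<in> hom (simplicial_homology G (K i) k) (simplicial_homology G (K j) k)"
    "\<And>i j. \<lbrakk>i \<in> T; j \<in> T; R i j\<rbrakk> \<Longrightarrow> induced_on_homology G (K i) (K j) k (\<phi> i j) (f i j)"
    by blast
  have "f j l (f i j x) = f i l x"
    if T: "i \<in> T" "j \<in> T" "l \<in> T" and R: "R i j" "R j l"
      and x: "x \<in> carrier (simplicial_homology G (K i) k)" for i j l x
  proof -
    obtain c where c: "c \<in> simplicial_cycles G (K i) k" "x = homology_class G (K i) k c"
      using x by (auto simp: carrier_simplicial_homology)
    have "\<phi> j l (\<phi> i j v) = \<phi> i l v" if "v \<in> \<Union> (K i)" for v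
      using filt T R that unfolding complex_filtration_def by blast
    then have "simplicial_chain_map G (\<phi> j l) (simplicial_chain_map G (\<phi> i j) c)
        = simplicial_chain_map G (\<phi> i l) c"
      by (rule simplicial_chain_map_comp[OF simplicial_cyclesD(1)[OF c(1)]])
    moreover have "simplicial_chain_map G (\<phi> i j) c \<in> simplicial_cycles G (K j) k"
      using simplicial_chain_map_cycle[OF \<phi>[OF T(1,2) R(1)] c(1)] .
    ultimately show ?thesis
      using f(2)[OF T(1,2) R(1)] f(2)[OF T(2,3) R(2)] f(2)[OF T(1,3) trans[OF R]] c
      by (simp add: induced_on_homology_def)
  qed
  then have "group_filtration T R (\<lambda>i. simplicial_homology G (K i) k) f"
    unfolding group_filtration_def using simplicial_homology_group[OF K] f(1) by blast
  with f(2) show ?thesis by blast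
qed

end

theorem theorem7:
  fixes X :: "'a::metric_space set"
    and J :: "'b set" and B :: "'b \<Rightarrow> 'a set"
    and MinPts m :: nat and eps :: "nat \<Rightarrow> real"
    and Cl :: "nat \<Rightarrow> 'b \<Rightarrow> 'a set list"
    and G :: "('g, 'm) monoid_scheme" and k :: int
  assumes "finite X"
    and "bin_collection X J B"
    and "MinPts > 0"
    and "\<And>i j. i \<le> j \<Longrightarrow> j \<le> m \<Longrightarrow> eps i \<le> eps j"
    and "\<And>i b. i \<le> m \<Longrightarrow> b \<in> J \<Longrightarrow> dbscan_output (B b) (eps i) MinPts (Cl i b)"
    and "\<And>i b s. i \<le> m \<Longrightarrow> b \<in> J \<Longrightarrow> \<not> free_border_point (B b) (eps i) MinPts s"
    and "comm_group G"
  shows "\<exists>u \<phi>.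
      cover_filtration {..m} (\<lambda>i j. eps i \<le> eps j) (\<lambda>i. cluster_cover J (Cl i)) (\<lambda>i. snd) u \<and>
      complex_filtration {..m} (\<lambda>i j. eps i \<le> eps j) (\<lambda>i. cluster_nerve J (Cl i)) \<phi> \<and>
      (\<forall>i\<le>m. \<forall>j\<le>m. eps i \<le> eps j \<longrightarrow>
         (\<forall>a \<in> cluster_cover J (Cl i). \<phi> i j a = u i j a)) \<and>
      (\<exists>f. group_filtration {..m} (\<lambda>i j. eps i \<le> eps j)
             (\<lambda>i. simplicial_homology G (cluster_nerve J (Cl i)) k) f \<and>
           (\<forall>i\<le>m. \<forall>j\<le>m. eps i \<le> eps j \<longrightarrow>
              induced_on_homology G (cluster_nerve J (Cl i)) (cluster_nerve J (Cl j)) k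
                (\<phi> i j) (f i j)))"
proof -
  let ?R = "\<lambda>i j. eps i \<le> eps j"
  have nest: "\<exists>!C'. C' \<in> set (Cl j b) \<and> C \<subseteq> C'"
    if "i \<in> {..m}" "j \<in> {..m}" "eps i \<le> eps j" "b \<in> J" "C \<in> set (Cl i b)" for i j b C
  proof -
    have "finite (B b)"
      using assms(1,2) \<open>b \<in> J\<close> unfolding bin_collection_def by (meson finite_subset)
    then show ?thesis
      using that assms(5)[of i b] assms(5)[of j b] assms(6)[of j b]
      by (intro dbscan_cluster_nested[of "B b" "eps i" "eps j" MinPts "Cl i b"]) auto
  qed
  have "\<exists>u. cover_filtration {..m} ?R (\<lambda>i. cluster_cover J (Cl i)) (\<lambda>i. snd) u"
    by (rule nested_covers_filtration) (rule order_trans, assumption+, rule nest)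
  then obtain u where u: "cover_filtration {..m} ?R (\<lambda>i. cluster_cover J (Cl i)) (\<lambda>i. snd) u"
    by blast
  then have complexes: "complex_filtration {..m} ?R (\<lambda>i. cluster_nerve J (Cl i)) u"
    unfolding cluster_nerve_def by (rule cover_filtration_imp_nerve_filtration)
  have "\<exists>f. group_filtration {..m} ?R (\<lambda>i. simplicial_homology G (cluster_nerve J (Cl i)) k) f \<and>
      (\<forall>i\<in>{..m}. \<forall>j\<in>{..m}. ?R i j \<longrightarrow>
         induced_on_homology G (cluster_nerve J (Cl i)) (cluster_nerve J (Cl j)) k (u i j) (f i j))"
    by (rule comm_group.complex_filtration_imp_homology_filtration[OF assms(7) complexes])
       (rule order_trans)
  then obtain f where
    "group_filtration {..m} ?R (\<lambda>i. simplicial_homology G (cluster_nerve J (Cl i)) k) f"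
    "\<forall>i\<in>{..m}. \<forall>j\<in>{..m}. ?R i j \<longrightarrow>
       induced_on_homology G (cluster_nerve J (Cl i)) (cluster_nerve J (Cl j)) k (u i j) (f i j)"
    by blast
  with u complexes show ?thesis
    by (intro exI[of _ u] conjI exI[of _ f]) auto
qed

end
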